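(* Let $\varphi\colon R\to S$ be a ring morphism and $(\mathfrak a,M)$, with $\mathfrak a=\ker(\varphi)$ and $M=\varphi^{-1}(U(S))$, its corresponding pair in $\operatorname{Hom}(R)$. Let $T$ be the subring of $S$ generated by $\varphi(R)$ and all the elements $\varphi(m)^{-1}$ ($m\in M$). Then the corestriction $\varphi|^T\colon R\to T$ is a ring epimorphism and its corresponding pair in $\operatorname{Hom}(R)$ is $(\mathfrak a,M)$.
   Context: All rings are associative with identity $1\neq 0$ and ring morphisms send $1$ to $1$. $U(S)$ denotes the group of two-sided invertible elements of a ring $S$. The pair corresponding to a ring morphism $\varphi\colon R\to S$ is $(\ker(\varphi),\varphi^{-1}(U(S)))$, and $\operatorname{Hom}(R)$ denotes the set of all such pairs, with $S$ ranging over all rings. A ring morphism $\varphi\colon R\to S$ is a ring epimorphism if for all ring morphisms $\psi,\psi'\colon S\to T$, $\psi\varphi=\psi'\varphi$ implies $\psi=\psi'$. *)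

theory Defs
  imports "HOL-Algebra.Algebra"
begin

text \<open>
  Library rings are associative and unital but may be trivial, and members of \<^const>\<open>ring_hom\<close>
  preserve \<open>\<one>\<close>.  Throughout, rings are required to satisfy \<open>\<one> \<noteq> \<zero>\<close>.
\<close>

locale nontrivial_ring = ring +
  assumes one_neq_zero: "\<one> \<noteq> \<zero>"

definition ring_morphism ::
    "('a, 'm) ring_scheme \<Rightarrow> ('b, 'n) ring_scheme \<Rightarrow> ('a \<Rightarrow> 'b) \<Rightarrow> bool" where
  "ring_morphism R S \<phi> \<longleftrightarrow> nontrivial_ring R \<and> nontrivial_ring S \<and> \<phi> \<in> ring_hom R S"

definition morphism_pair ::
    "('a, 'm) ring_scheme \<Rightarrow> ('b, 'n) ring_scheme \<Rightarrow> ('a \<Rightarrow> 'b) \<Rightarrow> 'a set \<times> 'a set" where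
  "morphism_pair R S \<phi> = (a_kernel R S \<phi>, {r \<in> carrier R. \<phi> r \<in> Units S})"

text \<open>
  HOL cannot quantify over types inside a formula.  In the next two definitions the type over
  which the codomain ring \<open>S\<close>, respectively the test ring \<open>U\<close>, ranges is therefore an explicit
  parameter.  A theorem concluding \<open>ring_epi TYPE('c) R S \<phi>\<close> for a type variable \<open>'c\<close> that occurs
  nowhere else covers all test rings.
\<close>

definition Hom_pairs ::
    "'b itself \<Rightarrow> ('a, 'm) ring_scheme \<Rightarrow> ('a set \<times> 'a set) set" where
  "Hom_pairs _ R = {morphism_pair R S \<phi> | (S :: 'b ring) \<phi>. ring_morphism R S \<phi>}"

text \<open>
  Morphisms are total functions on the underlying types, so only their values on the carrier of
  the domain are compared.
\<close>

definition ring_epi ::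
    "'c itself \<Rightarrow> ('a, 'm) ring_scheme \<Rightarrow> ('b, 'n) ring_scheme \<Rightarrow> ('a \<Rightarrow> 'b) \<Rightarrow> bool" where
  "ring_epi _ R S \<phi> \<longleftrightarrow> ring_morphism R S \<phi> \<and>
     (\<forall>(U :: 'c ring) \<psi> \<psi>'. ring_morphism S U \<psi> \<longrightarrow> ring_morphism S U \<psi>' \<longrightarrow>
        (\<forall>r \<in> carrier R. \<psi> (\<phi> r) = \<psi>' (\<phi> r)) \<longrightarrow> (\<forall>s \<in> carrier S. \<psi> s = \<psi>' s))"

end

theory Submission
  imports Defs
begin

text \<open>
  Two ring morphisms out of \<open>T\<close> that agree on \<open>\<phi>(R)\<close> also agree on the elements \<open>\<phi>(m)\<inverse>\<close>, because
  a morphism sends the inverse of a unit to the inverse of its image and inverses are unique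
  (\<open>ring_homs_agree_on_inverse\<close>).  So they agree on generators of \<open>T\<close> and hence everywhere
  (\<open>ring_homs_agree_on_generate_ring\<close>); this is the epimorphism property.

  The kernel does not change when \<open>\<phi>\<close> is corestricted to a subring.  The set of elements with
  invertible image could only shrink, since an element of \<open>T\<close> may have its inverse in \<open>S\<close> outside
  \<open>T\<close>; but \<open>T\<close> contains the inverse of \<open>\<phi>(m)\<close> for every \<open>m\<close> whose image is a unit of \<open>S\<close>.
\<close>

lemma ring_homs_agree_on_inverse:
  assumes "monoid U" and f: "f \<in> ring_hom T U" and g: "g \<in> ring_hom T U"
    and x: "x \<in> carrier T" and y: "y \<in> carrier T"
    and xy: "x \<otimes>\<^bsub>T\<^esub> y = \<one>\<^bsub>T\<^esub>" and yx: "y \<otimes>\<^bsub>T\<^esub> x = \<one>\<^bsub>T\<^esub>"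
    and eq: "f x = g x"
  shows "f y = g y"
proof (rule monoid.inv_unique[OF \<open>monoid U\<close>])
  show "f y \<otimes>\<^bsub>U\<^esub> f x = \<one>\<^bsub>U\<^esub>"
    using ring_hom_mult[OF f y x] yx ring_hom_one[OF f] by simp
  show "f x \<otimes>\<^bsub>U\<^esub> g y = \<one>\<^bsub>U\<^esub>"
    using ring_hom_mult[OF g x y] xy ring_hom_one[OF g] eq by simp
qed (simp_all add: x y ring_hom_closed[OF f] ring_hom_closed[OF g])

text \<open>
  The elements on which two ring morphisms agree are closed under the ring operations.
\<close>

lemma ring_homs_agree_on_generate_ring:
  fixes S (structure)
  assumes "ring S" and "ring U" and H: "H \<subseteq> carrier S"
    and f: "f \<in> ring_hom (S\<lparr>carrier := generate_ring S H\<rparr>) U"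
    and g: "g \<in> ring_hom (S\<lparr>carrier := generate_ring S H\<rparr>) U"
    and agree: "\<And>h. h \<in> H \<Longrightarrow> f h = g h"
    and s: "s \<in> generate_ring S H"
  shows "f s = g s"
proof -
  interpret S: ring S by fact
  interpret U: ring U by fact
  let ?T = "S\<lparr>carrier := generate_ring S H\<rparr>"
  have T: "ring ?T" by (rule S.generate_ring_is_ring[OF H])
  have f0: "f \<zero> = \<zero>\<^bsub>U\<^esub>" and g0: "g \<zero> = \<zero>\<^bsub>U\<^esub>"
    using ring_hom_zero[OF f T \<open>ring U\<close>] ring_hom_zero[OF g T \<open>ring U\<close>] by simp_all
  show ?thesis
    using s
  proof (induction rule: generate_ring.induct)
    case one
    then show ?case using ring_hom_one[OF f] ring_hom_one[OF g] by simp
  next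
    case (incl h)
    then show ?case by (rule agree)
  next
    case (a_inv h)
    have h: "h \<in> carrier S" and nh: "\<ominus> h \<in> generate_ring S H"
      using a_inv.hyps S.generate_ring_in_carrier[OF H] generate_ring.a_inv by auto
    \<comment> \<open>Both images of \<open>\<ominus> h\<close> are negatives of the common image of \<open>h\<close>.\<close>
    have "f (\<ominus> h) \<oplus>\<^bsub>U\<^esub> f h = \<zero>\<^bsub>U\<^esub>" "g (\<ominus> h) \<oplus>\<^bsub>U\<^esub> g h = \<zero>\<^bsub>U\<^esub>"
      using ring_hom_add[OF f, of "\<ominus> h" h] ring_hom_add[OF g, of "\<ominus> h" h]
        nh a_inv.hyps h f0 g0 by (simp_all add: S.l_neg)
    moreover have "f (\<ominus> h) \<in> carrier U" "g (\<ominus> h) \<in> carrier U" "g h \<in> carrier U"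
      using ring_hom_closed[OF f] ring_hom_closed[OF g] nh a_inv.hyps by auto
    ultimately show ?case
      using a_inv.IH by (metis U.add.inv_equality)
  next
    case (eng_add h1 h2)
    then show ?case
      using ring_hom_add[OF f, of h1 h2] ring_hom_add[OF g, of h1 h2] by simp
  next
    case (eng_mult h1 h2)
    then show ?case
      using ring_hom_mult[OF f, of h1 h2] ring_hom_mult[OF g, of h1 h2] by simp
  qed
qed

text \<open>
  An inverse inside \<open>H\<close> is also an inverse in the whole monoid, where it is unique.  So the
  only obstruction to invertibility inside \<open>H\<close> is that the inverse may lie outside \<open>H\<close>.
\<close>

lemma (in monoid) Units_carrier_update_iff:
  assumes "H \<subseteq> carrier G" and "x \<in> H"
  shows "x \<in> Units (G\<lparr>carrier := H\<rparr>) \<longleftrightarrow> x \<in> Units G \<and> inv x \<in> H"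
proof
  assume "x \<in> Units (G\<lparr>carrier := H\<rparr>)"
  then obtain y where y: "y \<in> H" "y \<otimes> x = \<one>" "x \<otimes> y = \<one>"
    by (auto simp: Units_def)
  then have "x \<in> Units G" using assms unfolding Units_def by auto
  moreover have "inv x = y"
    using y assms inv_unique'[of x y] by auto
  ultimately show "x \<in> Units G \<and> inv x \<in> H" using y by simp
next
  assume x: "x \<in> Units G \<and> inv x \<in> H"
  then have "inv x \<otimes> x = \<one>" "x \<otimes> inv x = \<one>" by simp_all
  moreover have "x \<in> carrier G" using assms by blast
  ultimately show "x \<in> Units (G\<lparr>carrier := H\<rparr>)"
    using x assms(2) unfolding Units_def[of "G\<lparr>carrier := H\<rparr>"]
    by (simp del: Units_r_inv Units_l_inv) blast
qed

theorem proposition7p2: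
  fixes R :: "'a ring" and S T :: "'b ring" and \<phi> :: "'a \<Rightarrow> 'b" and \<aa> M :: "'a set"
  assumes "ring_morphism R S \<phi>"
    and "\<aa> = a_kernel R S \<phi>"
    and "M = {r \<in> carrier R. \<phi> r \<in> Units S}"
    and "T = S\<lparr>carrier := generate_ring S (\<phi> ` carrier R \<union> {inv\<^bsub>S\<^esub> (\<phi> m) | m. m \<in> M})\<rparr>"
  shows "ring_epi TYPE('c) R T \<phi> \<and>
    morphism_pair R T \<phi> = (\<aa>, M) \<and> (\<aa>, M) \<in> Hom_pairs TYPE('b) R"
proof -
  define H where "H = \<phi> ` carrier R \<union> {inv\<^bsub>S\<^esub> (\<phi> m) | m. m \<in> M}"
  have T: "T = S\<lparr>carrier := generate_ring S H\<rparr>"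
    using assms(4) by (simp add: H_def)
  have \<phi>: "\<phi> \<in> ring_hom R S" and R: "nontrivial_ring R"
    using assms(1) by (simp_all add: ring_morphism_def)
  interpret S: nontrivial_ring S
    using assms(1) by (simp add: ring_morphism_def)
  have H: "H \<subseteq> carrier S"
    using ring_hom_closed[OF \<phi>] by (auto simp: H_def assms(3))
  have img: "\<phi> r \<in> generate_ring S H" if "r \<in> carrier R" for r
    using that by (intro generate_ring.incl) (simp add: H_def)
  have inv: "inv\<^bsub>S\<^esub> (\<phi> m) \<in> generate_ring S H" if "m \<in> M" for m
    using that by (intro generate_ring.incl) (auto simp: H_def)

  have "nontrivial_ring T"
    using S.generate_ring_is_ring[OF H] S.one_neq_zero
    by (simp add: T nontrivial_ring_def nontrivial_ring_axioms_def)
  moreover have "\<phi> \<in> ring_hom R T"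
    using \<phi> img by (auto simp: ring_hom_def T)
  ultimately have morph: "ring_morphism R T \<phi>"
    using R by (simp add: ring_morphism_def)

  have units: "\<phi> r \<in> Units T \<longleftrightarrow> \<phi> r \<in> Units S" if "r \<in> carrier R" for r
    using S.Units_carrier_update_iff[OF S.generate_ring_incl[OF H] img[OF that]] inv[of r] that
    by (auto simp: T assms(3))

  have "morphism_pair R T \<phi> = (\<aa>, M)"
    using units by (auto simp: morphism_pair_def a_kernel_def' assms(2,3) T)
  moreover have "(\<aa>, M) \<in> Hom_pairs TYPE('b) R"
    using assms(1-3) by (auto simp: Hom_pairs_def morphism_pair_def)
  moreover have "ring_epi TYPE('c) R T \<phi>"
    unfolding ring_epi_def
  proof (intro conjI morph allI impI ballI)
    fix U :: "'c ring" and \<psi> \<psi>' s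
    assume "ring_morphism T U \<psi>" "ring_morphism T U \<psi>'"
      and eq: "\<forall>r\<in>carrier R. \<psi> (\<phi> r) = \<psi>' (\<phi> r)" and s: "s \<in> carrier T"
    then have U: "ring U" and \<psi>: "\<psi> \<in> ring_hom T U" and \<psi>': "\<psi>' \<in> ring_hom T U"
      by (auto simp: ring_morphism_def nontrivial_ring_def)
    have on_inverses: "\<psi> (inv\<^bsub>S\<^esub> (\<phi> m)) = \<psi>' (inv\<^bsub>S\<^esub> (\<phi> m))" if "m \<in> M" for m
    proof (rule ring_homs_agree_on_inverse[OF ring.is_monoid[OF U] \<psi> \<psi>', of "\<phi> m"])
      show "\<phi> m \<in> carrier T" "inv\<^bsub>S\<^esub> (\<phi> m) \<in> carrier T" "\<psi> (\<phi> m) = \<psi>' (\<phi> m)"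
        "\<phi> m \<otimes>\<^bsub>T\<^esub> inv\<^bsub>S\<^esub> (\<phi> m) = \<one>\<^bsub>T\<^esub>" "inv\<^bsub>S\<^esub> (\<phi> m) \<otimes>\<^bsub>T\<^esub> \<phi> m = \<one>\<^bsub>T\<^esub>"
        using that img inv eq by (simp_all add: T assms(3))
    qed
    show "\<psi> s = \<psi>' s"
    proof (rule ring_homs_agree_on_generate_ring[OF S.ring_axioms U H])
      show "\<psi> \<in> ring_hom (S\<lparr>carrier := generate_ring S H\<rparr>) U"
        "\<psi>' \<in> ring_hom (S\<lparr>carrier := generate_ring S H\<rparr>) U" "s \<in> generate_ring S H"
        using \<psi> \<psi>' s by (simp_all add: T)
      show "\<psi> h = \<psi>' h" if "h \<in> H" for h
        using that eq on_inverses by (auto simp: H_def)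
    qed
  qed
  ultimately show ?thesis by simp
qed

end
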